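(* Let $A$ be an absolute retract, let $a,b\in\mathbb{R}$ with $a<b$, and set $$\mathcal{C}:=[a,b]\times A,\qquad \mathcal{C}_{l}:=\{a\}\times A,\qquad \mathcal{C}_{r}:=\{b\}\times A.$$ Let $D\subseteq\mathcal{C}$ and let $\phi=(\phi_1,\phi_2)\colon D\to\mathbb{R}\times A$ be a map. Suppose that there exists a set $W\subseteq D$, closed in $\mathbb{R}\times A$, such that (i) $\phi$ is compact on $W$; (ii) for every path $\sigma\subseteq\mathcal{C}$ with $\sigma\cap\mathcal{C}_{l}\neq\emptyset$ and $\sigma\cap\mathcal{C}_{r}\neq\emptyset$ there exists a sub-path $\gamma\subseteq\sigma\cap W$ with $\phi(\gamma)\subseteq\mathcal{C}$, $\phi(\gamma)\cap\mathcal{C}_{l}\neq\emptyset$ and $\phi(\gamma)\cap\mathcal{C}_{r}\neq\emptyset$. Then there exists $\tilde z\in W$ such that $\phi(\tilde z)=\tilde z$.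
   Context: A space $A$ is an absolute retract (AR) if $A$ is metrizable and, for every metrizable space $Y$ and every closed $M\subseteq Y$, each continuous function $f\colon M\to A$ extends continuously over $Y$. A map between metric (metrizable) spaces is compact if it is continuous and the closure of its image is a compact subset of the target space; "$\phi$ is compact on $W$" means that the restriction $\phi|_W$ is compact. No continuity of $\phi$ outside $W$ is assumed. A path is a continuous map $\sigma$ from a compact interval $I\subseteq\mathbb{R}$ (usually $I=[0,1]$) into $\mathbb{R}\times A$; its support is $\sigma(I)$. A sub-path of $\sigma$ is a restriction $\gamma=\sigma|_{[s_0,s_1]}$ with $[s_0,s_1]\subseteq I$. In set-theoretic expressions a path denotes its support: for a set $Z$, $\sigma\subseteq Z$ means $\sigma(I)\subseteq Z$, $\sigma\cap Z\neq\emptyset$ means $\sigma(I)\cap Z\neq\emptyset$, and $\phi(\gamma)$ is the image under $\phi$ of the support of $\gamma$. "A sub-path $\gamma\subseteq\sigma\cap W$" means a sub-path $\gamma$ of $\sigma$ whose support is contained in $W$. *)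

theory Defs
  imports "HOL-Analysis.Analysis"
begin

text \<open>
  The library predicate \<^const>\<open>AR\<close> compares a set only with the subsets of one particular type,
  and its extension property is established for Euclidean spaces only; hence the definition below.

  HOL cannot quantify over all metrizable spaces, so the spaces \<open>Y\<close> range over the metrizable
  topologies with points in \<^typ>\<open>'a \<Rightarrow> real\<close>.  This loses nothing: by the
  Kuratowski-Wojdyslawski theorem, a metrizable \<open>X\<close> with points in \<^typ>\<open>'a\<close> is homeomorphic to a
  closed subset of a convex subset \<open>Y\<close> of the normed space of bounded real functions on \<open>X\<close>, so
  that the property below makes \<open>X\<close> a retract of \<open>Y\<close>; Dugundji's theorem then yields the extension
  property for all metrizable spaces, over any type.
\<close>

definition absolute_retract :: "'a topology \<Rightarrow> bool" where
  "absolute_retract X \<longleftrightarrow>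
     metrizable_space X \<and>
     (\<forall>(Y :: ('a \<Rightarrow> real) topology) M f.
        metrizable_space Y \<and> closedin Y M \<and> continuous_map (subtopology Y M) X f \<longrightarrow>
        (\<exists>g. continuous_map Y X g \<and> (\<forall>y\<in>M. g y = f y)))"

definition compact_map :: "'a topology \<Rightarrow> 'b topology \<Rightarrow> ('a \<Rightarrow> 'b) \<Rightarrow> bool" where
  "compact_map X Y f \<longleftrightarrow>
     continuous_map X Y f \<and> compactin Y (Y closure_of (f ` topspace X))"

text \<open>Unlike \<^const>\<open>pathin\<close>, the parameter interval is arbitrary, so that the restriction of a path
  to a subinterval is again a path.\<close>

definition path_on :: "'a topology \<Rightarrow> real \<Rightarrow> real \<Rightarrow> (real \<Rightarrow> 'a) \<Rightarrow> bool" where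
  "path_on X s t \<sigma> \<longleftrightarrow> s \<le> t \<and> continuous_map (top_of_set {s..t}) X \<sigma>"

end

theory Submission
  imports Defs
begin

text \<open>
  Write \<open>\<phi> = (\<phi>\<^sub>1, \<phi>\<^sub>2)\<close>.  A fixed point of \<open>\<phi>\<close> in \<open>W\<close> is a pair \<open>(\<lambda>, x) \<in> W\<close> with \<open>x = \<phi>\<^sub>2(\<lambda>, x)\<close> and
  \<open>\<lambda> = \<phi>\<^sub>1(\<lambda>, x)\<close>.  The two equations are treated differently.  Once \<open>\<phi>\<^sub>2\<close> is extended from \<open>W\<close> to
  the cylinder, the first is a fixed-point problem in \<open>A\<close> that depends on the parameter \<open>\<lambda> \<in> [a, b]\<close>.
  By the continuation principle of Leray and Schauder its solutions contain a connected set that runs from \<open>\<lambda> = a\<close> to \<open>\<lambda> = b\<close>; hence paths \<open>\<sigma>\<close> of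
  arbitrarily good approximate solutions join the two faces of the cylinder.  The stretching
  hypothesis applied to \<open>\<sigma>\<close> gives a sub-path in \<open>W\<close> on which \<open>\<phi>\<^sub>1\<close> takes both values \<open>a\<close> and \<open>b\<close>, while
  \<open>\<lambda>\<close> stays in \<open>[a, b]\<close>; by the intermediate value theorem the second equation holds exactly somewhere
  on it.  So the second equation holds exactly and the first one approximately, at points of \<open>W\<close>;
  compactness turns the approximate solutions into an exact one.

  To make this work without an index theory on absolute retracts, the parametrized problem is moved
  into the Hilbert cube.  Let \<open>K\<close> be a compact set that contains the values of \<open>\<phi>\<^sub>2\<close> on \<open>W\<close>.  By
  \<open>absolute_retract_factors_through_sequences\<close> there are continuous maps \<open>h\<close> from \<open>A\<close> to the Hilbert cube
  and \<open>R\<close> from the space of real sequences to \<open>A\<close> with \<open>R \<circ> h = id\<close> on \<open>K\<close>.  Each coordinate of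
  \<open>h \<circ> \<phi>\<^sub>2\<close>, defined on the closed set \<open>W\<close>, extends to the whole product by Tietze's theorem with values
  in \<open>[0, 1]\<close>.  Composed with \<open>(\<lambda>, u) \<mapsto> (\<lambda>, R u)\<close> these extensions form a map \<open>G\<close> from
  \<open>[a, b]\<close> times the cube to the cube.  If \<open>u = G(\<lambda>, u)\<close> and \<open>z = (\<lambda>, R u) \<in> W\<close>, then \<open>u = h(\<phi>\<^sub>2 z)\<close>, so that
  \<open>R u = R(h(\<phi>\<^sub>2 z)) = \<phi>\<^sub>2 z\<close>, which is the first equation.

  The continuation principle for \<open>G\<close> is \<open>approximate_solution_path\<close>.  It comes directly from Kuhn's
  cubical form of Sperner's lemma: the labels in the directions of the cube record the sign of
  \<open>G(\<lambda>, u) - u\<close>, and the label in the direction of \<open>\<lambda>\<close> records whether a grid point can be reached from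
  the face \<open>\<lambda> = a\<close> by a path of approximate solutions.
\<close>

section \<open>Paths of approximate solutions in the Hilbert cube\<close>

definition Hilbert_cube :: "(nat \<Rightarrow> real) set" where
  "Hilbert_cube = {u. \<forall>k. u k \<in> {0..1}}"

lemma compact_Hilbert_cube: "compact Hilbert_cube"
proof -
  have "compactin (product_topology (\<lambda>_::nat. euclideanreal) UNIV) (Pi\<^sub>E UNIV (\<lambda>_. {0..1}))"
    by (simp add: compactin_PiE)
  moreover have "Pi\<^sub>E UNIV (\<lambda>_. {0..1}) = Hilbert_cube"
    by (auto simp: Hilbert_cube_def PiE_def Pi_def extensional_def)
  ultimately show ?thesis
    by (simp add: euclidean_product_topology)
qed

text \<open>
  The distance of two sequences is controlled by finitely many of their coordinates.  This reduces
  the continuation principle in the Hilbert cube to a grid of finite dimension.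
\<close>

lemma dist_sequences_less:
  assumes "0 < \<delta>"
  obtains M \<eta> where "0 < \<eta>"
    "\<And>x y :: nat \<Rightarrow> real. (\<And>k. k < M \<Longrightarrow> \<bar>x k - y k\<bar> < \<eta>) \<Longrightarrow> dist x y < \<delta>"
proof -
  obtain N where N: "(1/2::real)^N < \<delta>/2"
    using real_arch_pow_inv[of "\<delta>/2" "1/2"] assms by auto
  \<comment> \<open>The metric enumerates the index type by \<^const>\<open>from_nat\<close>, which on \<^typ>\<open>nat\<close> need not be the identity,
    so the first terms of its series are the coordinates in \<open>J\<close>.\<close>
  define J where "J = (from_nat :: nat \<Rightarrow> nat) ` {..N}"
  have J: "finite J" by (simp add: J_def)
  show ?thesis
  proof (rule that[of "\<delta>/8" "Suc (Max J)"])
    show "0 < \<delta>/8" using assms by simp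
    fix x y :: "nat \<Rightarrow> real"
    assume near: "\<And>k. k < Suc (Max J) \<Longrightarrow> \<bar>x k - y k\<bar> < \<delta>/8"
    have "Max {dist (x (from_nat n)) (y (from_nat n)) |n. n \<le> N} \<le> \<delta>/8"
    proof (rule Max.boundedI)
      fix e assume "e \<in> {dist (x (from_nat n)) (y (from_nat n)) |n. n \<le> N}"
      then obtain n where n: "n \<le> N" "e = dist (x (from_nat n)) (y (from_nat n))" by auto
      have "from_nat n \<in> J" using n by (auto simp: J_def)
      then have "from_nat n < Suc (Max J)" using J by (simp add: less_Suc_eq_le)
      then show "e \<le> \<delta>/8" using near[of "from_nat n"] n(2) by (simp add: dist_real_def)
    qed auto
    then show "dist x y < \<delta>"
      using dist_fun_le_dist_first_terms[of x y N] N assms by linarith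
  qed
qed

lemma path_component_box:
  fixes c d :: real and l h :: "nat \<Rightarrow> real"
  defines "C \<equiv> {c..d} \<times> {u. \<forall>k. l k \<le> u k \<and> u k \<le> h k}"
  assumes x: "x \<in> C" and y: "y \<in> C"
  shows "path_component C x y"
proof -
  define g where "g t = ((1 - t) * fst x + t * fst y, \<lambda>k. (1 - t) * snd x k + t * snd y k)" for t
  have conv: "\<alpha> \<le> (1 - t) * v + t * w \<and> (1 - t) * v + t * w \<le> \<beta>"
    if "v \<in> {\<alpha>..\<beta>}" "w \<in> {\<alpha>..\<beta>}" "0 \<le> t" "t \<le> 1" for \<alpha> \<beta> t v w :: real
    using convexD_alt[OF convex_real_interval(5) that] by simp
  have "path g"
    unfolding path_def g_def by (intro continuous_intros)
  moreover have "g t \<in> C" if "t \<in> {0..1}" for t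
  proof -
    have "fst (g t) \<in> {c..d}"
      using conv[of "fst x" c d "fst y" t] x y that by (auto simp: g_def C_def)
    moreover have "l k \<le> snd (g t) k \<and> snd (g t) k \<le> h k" for k
      using conv[of "snd x k" "l k" "h k" "snd y k" t] x y that by (auto simp: g_def C_def)
    ultimately show ?thesis by (auto simp: C_def mem_Times_iff)
  qed
  then have "path_image g \<subseteq> C"
    by (auto simp: path_image_def)
  moreover have "pathstart g = x" "pathfinish g = y"
    by (simp_all add: pathstart_def pathfinish_def g_def)
  ultimately show ?thesis
    by (auto simp: path_component_def)
qed

text \<open>
  The cylinder is compact, so \<open>G\<close> is uniformly continuous on it.  Closeness is measured in each
  coordinate separately because this is how the cells of a grid are small.
\<close>

lemma uniform_modulus_on_cylinder:
  fixes G :: "real \<times> (nat \<Rightarrow> real) \<Rightarrow> nat \<Rightarrow> real"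
  assumes G: "continuous_on ({a..b} \<times> Hilbert_cube) G" and \<eta>: "0 < \<eta>"
  obtains \<rho> where "0 < \<rho>"
    "\<And>x y k. \<lbrakk>x \<in> {a..b} \<times> Hilbert_cube; y \<in> {a..b} \<times> Hilbert_cube; k < M;
        \<bar>fst x - fst y\<bar> < \<rho>; \<And>j. \<bar>snd x j - snd y j\<bar> < \<rho>\<rbrakk> \<Longrightarrow> \<bar>G x k - G y k\<bar> < \<eta>"
proof -
  let ?B = "{a..b} \<times> Hilbert_cube"
  have "compact ?B" by (simp add: compact_Times compact_Hilbert_cube)
  then have "uniformly_continuous_on ?B (\<lambda>x. G x k)" for k
    using compact_uniformly_continuous[OF continuous_on_product_then_coordinatewise[OF G]] by simp
  then have "\<exists>e>0. \<forall>x\<in>?B. \<forall>y\<in>?B. dist y x < e \<longrightarrow> dist (G y k) (G x k) < \<eta>" for k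
    using \<eta> unfolding uniformly_continuous_on_def by blast
  then obtain e where e: "\<And>k. 0 < e k"
    "\<And>k x y. \<lbrakk>x \<in> ?B; y \<in> ?B; dist y x < e k\<rbrakk> \<Longrightarrow> dist (G y k) (G x k) < \<eta>"
    by metis
  define \<epsilon> where "\<epsilon> = Min (insert 1 (e ` {..<M}))"
  have \<epsilon>: "0 < \<epsilon>" "k < M \<Longrightarrow> \<epsilon> \<le> e k" for k
    using e(1) by (auto simp: \<epsilon>_def)
  obtain M' \<eta>' where \<eta>': "0 < \<eta>'"
    "\<And>u v :: nat \<Rightarrow> real. (\<And>j. j < M' \<Longrightarrow> \<bar>u j - v j\<bar> < \<eta>') \<Longrightarrow> dist u v < \<epsilon>/2"
    using dist_sequences_less[of "\<epsilon>/2"] \<epsilon> by (metis half_gt_zero)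
  show ?thesis
  proof (rule that[of "min (\<epsilon>/2) \<eta>'"])
    show "0 < min (\<epsilon>/2) \<eta>'" using \<epsilon> \<eta>' by simp
    fix x y k
    assume xy: "x \<in> ?B" "y \<in> ?B" and k: "k < M" and
      f: "\<bar>fst x - fst y\<bar> < min (\<epsilon>/2) \<eta>'" and s: "\<And>j. \<bar>snd x j - snd y j\<bar> < min (\<epsilon>/2) \<eta>'"
    have "dist (fst x) (fst y) < \<epsilon>/2" using f by (simp add: dist_real_def)
    moreover have "dist (snd x) (snd y) < \<epsilon>/2" using \<eta>'(2) s by simp
    ultimately have "dist x y < \<epsilon>"
      unfolding dist_prod_def
      using sqrt_sum_squares_le_sum[of "dist (fst x) (fst y)" "dist (snd x) (snd y)"] by simp
    then show "\<bar>G x k - G y k\<bar> < \<eta>"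
      using e(2)[of y x k] xy \<epsilon>(2)[OF k] by (simp add: dist_real_def)
  qed
qed

text \<open>
  The grid point with coordinates \<open>q\<close> has \<open>q 0\<close> steps in the direction of the parameter and \<open>q (Suc k)\<close>
  steps in the direction of coordinate \<open>k\<close>; only the coordinates \<open>k < M\<close> that decide the accuracy \<open>\<delta>\<close>
  are subdivided, the others are \<open>0\<close>.  Suppose that no grid point on the face over \<open>b\<close> is reachable from
  the face over \<open>a\<close> by a path of approximate solutions.  Then the labelling satisfies the boundary
  conditions of Kuhn's lemma, so some cell carries both labels in every direction.  Both labels in
  each direction \<open>Suc k\<close> mean that \<open>G\<close> minus the coordinate changes sign in the cell, so the whole cell,
  being small, consists of approximate solutions.  Both labels in direction \<open>0\<close> mean that one vertex of
  this cell is reachable and another one is not, although a segment in the cell joins them.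
\<close>

lemma approximate_solution_path:
  fixes G :: "real \<times> (nat \<Rightarrow> real) \<Rightarrow> nat \<Rightarrow> real"
  assumes ab: "a < b" and G: "continuous_on ({a..b} \<times> Hilbert_cube) G"
    and GQ: "G \<in> {a..b} \<times> Hilbert_cube \<rightarrow> Hilbert_cube" and \<delta>: "0 < \<delta>"
  obtains p where "path p"
    "path_image p \<subseteq> {x \<in> {a..b} \<times> Hilbert_cube. dist (snd x) (G x) < \<delta>}"
    "fst (pathstart p) = a" "fst (pathfinish p) = b"
proof -
  let ?B = "{a..b} \<times> Hilbert_cube"
  define U where "U = {x \<in> ?B. dist (snd x) (G x) < \<delta>}"
  obtain M \<eta> where \<eta>: "0 < \<eta>"
    "\<And>u v :: nat \<Rightarrow> real. (\<And>k. k < M \<Longrightarrow> \<bar>u k - v k\<bar> < \<eta>) \<Longrightarrow> dist u v < \<delta>"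
    using dist_sequences_less[OF \<delta>] by metis
  have "0 < \<eta>/2" using \<eta> by simp
  then obtain \<rho> where \<rho>: "0 < \<rho>"
    "\<And>x y k. \<lbrakk>x \<in> ?B; y \<in> ?B; k < M; \<bar>fst x - fst y\<bar> < \<rho>; \<And>j. \<bar>snd x j - snd y j\<bar> < \<rho>\<rbrakk>
      \<Longrightarrow> \<bar>G x k - G y k\<bar> < \<eta>/2"
    using uniform_modulus_on_cylinder[OF G, of "\<eta>/2" M] by metis
  \<comment> \<open>The number \<open>P\<close> of subdivisions makes the steps \<open>(b - a) / P\<close> and \<open>1 / P\<close> both small enough.\<close>
  obtain P :: nat where P: "(b - a + 1) / min \<rho> (\<eta>/2) < P"
    using reals_Archimedean2 by blast
  have m: "0 < min \<rho> (\<eta>/2)" using \<rho> \<eta> by simp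
  have "0 < (b - a + 1) / min \<rho> (\<eta>/2)" using m ab by simp
  then have P0: "0 < P" using P by (metis less_trans of_nat_0_less_iff)
  have "(b - a + 1) / P < min \<rho> (\<eta>/2)"
    using P P0 m by (simp only: pos_divide_less_eq of_nat_0_less_iff mult.commute)
  moreover have "(b - a) / P \<ge> 0" "1 / real P > 0" using ab P0 by auto
  ultimately have mesh: "(b - a) / P < \<rho>" "1 / P < \<rho>" "1 / P < \<eta>/2"
    using add_divide_distrib[of "b - a" 1 "real P"] by linarith+

  define pt where "pt q = (a + (b - a) * (real (q 0) / P), \<lambda>k. if k < M then real (q (Suc k)) / P else 0)"
    for q :: "nat \<Rightarrow> nat"
  have pt_B: "pt q \<in> ?B" if "\<And>i. i < Suc M \<Longrightarrow> q i \<le> P" for q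
  proof -
    have *: "0 \<le> real (q i) / P \<and> real (q i) / P \<le> 1" if "i < Suc M" for i
      using \<open>\<And>i. i < Suc M \<Longrightarrow> q i \<le> P\<close>[OF that] P0 by simp
    have "(b - a) * (real (q 0) / P) \<le> (b - a) * 1"
      using *[of 0] ab by (intro mult_left_mono) auto
    then show ?thesis using * ab by (auto simp: pt_def Hilbert_cube_def)
  qed
  define V where "V = {q. \<exists>x0. fst x0 = a \<and> path_component U x0 (pt q)}"
  \<comment> \<open>Label \<open>0\<close> means that the coordinate wants to grow.  In direction \<open>0\<close> this imitates a map that sends
    reachable points to the face over \<open>b\<close> and the others to the face over \<open>a\<close>; the disjunct \<open>q 0 = 0\<close> and
    the conjunct \<open>q i \<noteq> P\<close> enforce the boundary conditions of Kuhn's lemma.\<close>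
  define label where "label q i =
    (if i = 0 then if q 0 = 0 \<or> q \<in> V then 0 else 1
     else if snd (pt q) (i - 1) \<le> G (pt q) (i - 1) \<and> q i \<noteq> P then 0 else (1::nat))" for q i
  have "\<exists>q\<in>V. q 0 = P"
  proof (rule ccontr)
    assume none: "\<not> (\<exists>q\<in>V. q 0 = P)"
    have lab0: "label q i = 0" if q: "\<forall>i<Suc M. q i \<le> P" and i: "i < Suc M" "q i = 0" for q i
    proof (cases i)
      case 0
      then show ?thesis using i by (simp add: label_def)
    next
      case (Suc k)
      then have "G (pt q) \<in> Hilbert_cube" "snd (pt q) k = 0"
        using GQ pt_B q i by (auto simp: pt_def)
      then show ?thesis using Suc i P0 by (auto simp: label_def Hilbert_cube_def)
    qed
    have lab1: "label q i = 1" if i: "i < Suc M" "q i = P" for q i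
      using i none P0 by (cases i) (auto simp: label_def)
    obtain q where q: "\<forall>i<Suc M. q i < P"
      and mixed: "\<forall>i<Suc M. \<exists>r s. (\<forall>j<Suc M. q j \<le> r j \<and> r j \<le> q j + 1) \<and>
        (\<forall>j<Suc M. q j \<le> s j \<and> s j \<le> q j + 1) \<and> label r i \<noteq> label s i"
      by (rule kuhn_lemma[of P "Suc M" label])
        (use P0 lab0 lab1 in \<open>auto simp: label_def\<close>)
    define cell where "cell r \<longleftrightarrow> (\<forall>j<Suc M. q j \<le> r j \<and> r j \<le> q j + 1)" for r
    have both_labels: "\<exists>r s. cell r \<and> cell s \<and> label r i = 0 \<and> label s i = 1" if i: "i < Suc M" for i
    proof -
      obtain r s where rs: "cell r" "cell s" "label r i \<noteq> label s i"
        using mixed[rule_format, OF i] unfolding cell_def by (elim exE conjE)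
      have "label t i = 0 \<or> label t i = 1" for t by (simp add: label_def)
      then show ?thesis using rs by metis
    qed
    \<comment> \<open>The convex hull \<open>C\<close> of the cell, degenerate in the directions that are not subdivided.\<close>
    define l where "l k = (if k < M then real (q (Suc k)) / P else 0)" for k
    define h where "h k = (if k < M then real (q (Suc k) + 1) / P else 0)" for k
    define C where "C = {a + (b - a) * (real (q 0) / P)..a + (b - a) * (real (q 0 + 1) / P)}
      \<times> {u. \<forall>k. l k \<le> u k \<and> u k \<le> h k}"
    have q1: "real (q i + 1) / P \<le> 1" if "i < Suc M" for i
    proof -
      have "real (q i + 1) \<le> real P" using q that by (metis Suc_eq_plus1 Suc_leI of_nat_le_iff)
      then show ?thesis using P0 by simp
    qed
    have C_B: "x \<in> ?B" if x: "x \<in> C" for x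
    proof -
      have "(b - a) * (real (q 0 + 1) / P) \<le> (b - a) * 1"
        using q1[of 0] ab by (intro mult_left_mono) auto
      moreover have "0 \<le> (b - a) * (real (q 0) / P)" using ab by simp
      ultimately have "fst x \<in> {a..b}" using x unfolding C_def by (simp add: mem_Times_iff)
      moreover have "0 \<le> l k" "h k \<le> 1" for k
        using q1[of "Suc k"] by (simp_all add: l_def h_def)
      then have "0 \<le> snd x k \<and> snd x k \<le> 1" for k
        using x unfolding C_def mem_Times_iff mem_Collect_eq by (meson order_trans)
      ultimately show ?thesis by (simp add: mem_Times_iff Hilbert_cube_def)
    qed
    have close: "\<bar>fst x - fst y\<bar> < \<rho> \<and> \<bar>snd x k - snd y k\<bar> \<le> 1 / P" if "x \<in> C" "y \<in> C" for x y k
    proof -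
      have "(b - a) * (real (q 0 + 1) / P) = (b - a) * (real (q 0) / P) + (b - a) / P"
        by (simp add: add_divide_distrib distrib_left)
      moreover have "h k \<le> l k + 1 / P" by (simp add: h_def l_def add_divide_distrib)
      moreover have "l k \<le> snd x k \<and> snd x k \<le> h k \<and> l k \<le> snd y k \<and> snd y k \<le> h k"
        using that unfolding C_def by (simp add: mem_Times_iff)
      moreover have "a + (b - a) * (real (q 0) / P) \<le> fst x \<and> fst x \<le> a + (b - a) * (real (q 0 + 1) / P)
          \<and> a + (b - a) * (real (q 0) / P) \<le> fst y \<and> fst y \<le> a + (b - a) * (real (q 0 + 1) / P)"
        using that unfolding C_def by (simp only: mem_Times_iff atLeastAtMost_iff)
      ultimately show ?thesis using mesh(1) by linarith
    qed
    have osc: "\<bar>G x k - G y k\<bar> < \<eta>/2" if "x \<in> C" "y \<in> C" "k < M" for x y k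
      using \<rho>(2)[OF C_B C_B, OF that(1,2,3)] close[OF that(1,2)] mesh(2)
      by (meson le_less_trans)
    have pt_C: "pt r \<in> C" if "cell r" for r
    proof -
      have bounds: "real (q j) / P \<le> real (r j) / P \<and> real (r j) / P \<le> real (q j + 1) / P" if "j < Suc M" for j
        using \<open>cell r\<close> that unfolding cell_def
        by (metis divide_right_mono of_nat_0_le_iff of_nat_le_iff)
      have "(b - a) * (real (q 0) / P) \<le> (b - a) * (real (r 0) / P)"
        "(b - a) * (real (r 0) / P) \<le> (b - a) * (real (q 0 + 1) / P)"
        using bounds[of 0] ab by (intro mult_left_mono; simp)+
      moreover have "l k \<le> snd (pt r) k \<and> snd (pt r) k \<le> h k" for k
        using bounds[of "Suc k"] by (simp add: pt_def l_def h_def)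
      ultimately show ?thesis
        unfolding C_def mem_Times_iff atLeastAtMost_iff mem_Collect_eq by (simp add: pt_def)
    qed
    have C_U: "C \<subseteq> U"
    proof
      fix x assume x: "x \<in> C"
      have "\<bar>snd x k - G x k\<bar> < \<eta>" if k: "k < M" for k
      proof -
        obtain r s where r: "cell r" "label r (Suc k) = 0" and s: "cell s" "label s (Suc k) = 1"
          using both_labels[of "Suc k"] k by auto
        have C: "pt r \<in> C" "pt s \<in> C" using pt_C r s by auto
        have "snd (pt r) k \<le> G (pt r) k" using r(2) by (auto simp: label_def split: if_splits)
        moreover have "G (pt s) k \<le> snd (pt s) k"
        proof (cases "s (Suc k) = P")
          case True
          have "G (pt s) \<in> Hilbert_cube" using C_B[OF C(2)] GQ by auto
          then show ?thesis using True k P0 by (auto simp: pt_def Hilbert_cube_def)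
        next
          case False
          then show ?thesis using s(2) by (auto simp: label_def split: if_splits)
        qed
        ultimately show ?thesis
          using osc[OF x C(1) k] osc[OF x C(2) k] close[OF x C(1), of k] close[OF x C(2), of k] mesh(3)
          by linarith
      qed
      then show "x \<in> U" using \<eta>(2) C_B[OF x] by (auto simp: U_def)
    qed
    obtain r s where r: "cell r" "label r 0 = 0" and s: "cell s" "label s 0 = 1"
      using both_labels[of 0] by auto
    \<comment> \<open>Points on the face over \<open>a\<close> get label \<open>0\<close> by force; as a point of \<open>C\<close>, such a vertex is an
      approximate solution and is reachable by the constant path.\<close>
    have "r \<in> V"
    proof (cases "r 0 = 0")
      case True
      then have "fst (pt r) = a" by (simp add: pt_def)
      moreover have "path_component U (pt r) (pt r)"
        using pt_C[OF r(1)] C_U by (auto intro: path_component_refl)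
      ultimately show ?thesis unfolding V_def by blast
    next
      case False
      then show ?thesis using r(2) by (auto simp: label_def split: if_splits)
    qed
    then obtain x0 where "fst x0 = a" "path_component U x0 (pt r)" unfolding V_def by blast
    moreover have "path_component C (pt r) (pt s)"
      using pt_C[OF r(1)] pt_C[OF s(1)] unfolding C_def by (rule path_component_box)
    then have "path_component U (pt r) (pt s)" using C_U path_component_of_subset by metis
    ultimately have "s \<in> V"
      unfolding V_def mem_Collect_eq using path_component_trans[of U x0 "pt r" "pt s"] by metis
    then show False using s(2) by (simp add: label_def)
  qed
  then obtain q x0 where q: "q 0 = P" "fst x0 = a" "path_component U x0 (pt q)"
    unfolding V_def by blast
  then obtain p where "path p" "path_image p \<subseteq> U" "pathstart p = x0" "pathfinish p = pt q"
    by (auto simp: path_component_def)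
  moreover have "fst (pt q) = b" using q(1) P0 by (simp add: pt_def)
  ultimately show ?thesis using that q(2) by (simp add: U_def)
qed

section \<open>Compact subsets of absolute retracts and the Hilbert cube\<close>

lemma compactin_metrizable_countable_dense:
  assumes "Metric_space S d" and K: "compactin (Metric_space.mtopology S d) K"
  obtains E where "countable E" "E \<subseteq> K"
    "\<And>x e. \<lbrakk>x \<in> K; 0 < e\<rbrakk> \<Longrightarrow> \<exists>c\<in>E. d x c < e"
proof -
  interpret Metric_space S d by fact
  have "\<exists>F. finite F \<and> F \<subseteq> K \<and> K \<subseteq> (\<Union>x\<in>F. mball x (1 / real (Suc n)))" for n
    using compactin_imp_mtotally_bounded[OF K] unfolding mtotally_bounded_def by simp
  then obtain F where F: "\<And>n. finite (F n)" "\<And>n. F n \<subseteq> K"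
    "\<And>n. K \<subseteq> (\<Union>x\<in>F n. mball x (1 / real (Suc n)))"
    by metis
  show ?thesis
  proof (rule that[of "\<Union>n. F n"])
    show "countable (\<Union>n. F n)" using F(1) by (simp add: countable_finite)
    show "(\<Union>n. F n) \<subseteq> K" using F(2) by blast
    fix x and e :: real assume "x \<in> K" "0 < e"
    then obtain n where "1 / real (Suc n) < e" using nat_approx_posE by blast
    moreover obtain c where "c \<in> F n" "x \<in> mball c (1 / real (Suc n))"
      using F(3)[of n] \<open>x \<in> K\<close> by blast
    ultimately have "d x c < e" by (auto simp: commute)
    then show "\<exists>c\<in>\<Union>n. F n. d x c < e" using \<open>c \<in> F n\<close> by blast
  qed
qed

text \<open>
  The distances to a countable dense subset \<open>E\<close> of \<open>K\<close>, truncated at \<open>1\<close>, embed \<open>K\<close> in the product of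
  copies of the real line indexed by \<open>E\<close>.  The points of this product are functions from the type of
  \<open>A\<close> to the reals, so it is one of the spaces \<open>Y\<close> in the definition of an absolute retract, and it is
  metrizable because \<open>E\<close> is countable.  The compact image of \<open>K\<close> is closed in it, hence the inverse of
  the embedding extends to a map \<open>r\<close> on the whole product.  An enumeration of \<open>E\<close> then replaces the
  index set \<open>E\<close> by the natural numbers.
\<close>

lemma absolute_retract_factors_through_sequences:
  fixes A :: "'a topology"
  assumes AR: "absolute_retract A" and K: "compactin A K"
  obtains h :: "'a \<Rightarrow> nat \<Rightarrow> real" and R where
    "continuous_map A euclidean h" "\<And>y k. y \<in> topspace A \<Longrightarrow> h y k \<in> {0..1}"
    "continuous_map euclidean A R" "\<And>y. y \<in> K \<Longrightarrow> R (h y) = y"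
proof -
  obtain S d where "Metric_space S d" and A: "A = Metric_space.mtopology S d"
    using AR unfolding absolute_retract_def metrizable_space_def by blast
  interpret Metric_space S d by fact
  obtain E where E: "countable E" "E \<subseteq> K"
    and dense: "\<And>x e. \<lbrakk>x \<in> K; 0 < e\<rbrakk> \<Longrightarrow> \<exists>c\<in>E. d x c < e"
    using compactin_metrizable_countable_dense[OF \<open>Metric_space S d\<close>] K A by metis
  have KS: "K \<subseteq> S" using compactin_subset_topspace[OF K] A by simp
  define \<delta> where "\<delta> c y = min 1 (d y c)" for c y
  have cont_\<delta>: "continuous_map A euclideanreal (\<delta> c)" if "c \<in> E" for c
  proof -
    have "continuous_map A euclideanreal (\<lambda>y. mdist (metric (S, d)) y c)"
      by (rule continuous_map_mdist)
        (use that E KS in \<open>auto simp: A mtopology_of\<close>)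
    then have "continuous_map A euclideanreal (\<lambda>y. d y c)" by simp
    then show ?thesis unfolding \<delta>_def by (intro continuous_intros) auto
  qed
  have \<delta>01: "\<delta> c y \<in> {0..1}" for c y by (simp add: \<delta>_def)

  define Y where "Y = powertop_real E"
  define i where "i y = (\<lambda>c\<in>E. \<delta> c y)" for y
  have Y: "metrizable_space Y"
    unfolding Y_def metrizable_space_product_topology
    using E(1) by (auto simp: metrizable_space_euclidean)
  have cont_i: "continuous_map A Y i"
    unfolding Y_def i_def continuous_map_componentwise using cont_\<delta> by auto
  have inj: "inj_on i K"
  proof (rule inj_onI, rule ccontr)
    fix x y assume xy: "x \<in> K" "y \<in> K" "i x = i y" "x \<noteq> y"
    then have pos: "0 < d x y" using KS by (meson mdist_pos_less subsetD)
    obtain c where c: "c \<in> E" "d x c < min 1 (d x y / 2)"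
      using dense[OF xy(1), of "min 1 (d x y / 2)"] pos by auto
    \<comment> \<open>The truncation is inactive at \<open>x\<close>, hence also at \<open>y\<close>.\<close>
    have "\<delta> c x = \<delta> c y" using xy(3) c(1) unfolding i_def by (metis restrict_apply')
    then have "d y c < d x y / 2" using c(2) by (auto simp: \<delta>_def)
    moreover have "d x y \<le> d x c + d y c"
      using triangle''[of x y c] triangle[of x c y] commute xy c E KS by (metis subsetD)
    ultimately show False using c(2) by simp
  qed
  have contK: "continuous_map (subtopology A K) Y i"
    using cont_i by (rule continuous_map_from_subtopology)
  have "homeomorphic_map (subtopology A K) (subtopology Y (i ` K)) i"
  proof (rule continuous_imp_homeomorphic_map)
    show "continuous_map (subtopology A K) (subtopology Y (i ` K)) i"
      using contK by (auto simp: continuous_map_in_subtopology)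
    show "compact_space (subtopology A K)" using K by (simp add: compact_space_subtopology)
    show "Hausdorff_space (subtopology Y (i ` K))"
      using Y by (simp add: Hausdorff_space_subtopology metrizable_imp_Hausdorff_space)
    show "i ` topspace (subtopology A K) = topspace (subtopology Y (i ` K))"
      using cont_i KS by (auto simp: A continuous_map_def)
    show "inj_on i (topspace (subtopology A K))" using inj by (auto intro: inj_on_subset)
  qed
  then obtain j where j: "homeomorphic_maps (subtopology A K) (subtopology Y (i ` K)) i j"
    by (auto simp: homeomorphic_map_maps)
  then have cont_j: "continuous_map (subtopology Y (i ` K)) A j"
    by (auto simp: homeomorphic_maps_def continuous_map_in_subtopology)
  have ji: "j (i y) = y" if "y \<in> K" for y
    using j that KS by (auto simp: homeomorphic_maps_def A)
  have "closedin Y (i ` K)"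
    using Y K cont_i compactin_imp_closedin image_compactin metrizable_imp_Hausdorff_space by blast
  then have "\<exists>r. continuous_map Y A r \<and> (\<forall>u\<in>i ` K. r u = j u)"
    using AR[unfolded absolute_retract_def, THEN conjunct2, rule_format, of Y "i ` K" j] Y cont_j
    by simp
  then obtain r where r: "continuous_map Y A r" "\<And>u. u \<in> i ` K \<Longrightarrow> r u = j u" by blast

  \<comment> \<open>If \<open>E\<close> is empty, \<^const>\<open>from_nat_into\<close> returns an arbitrary point, perhaps outside \<open>A\<close>; the test
    keeps \<open>h\<close> continuous.\<close>
  define h where "h y k = (if from_nat_into E k \<in> E then \<delta> (from_nat_into E k) y else 0)" for y k
  define R where "R v = r (\<lambda>c\<in>E. v (to_nat_on E c))" for v :: "nat \<Rightarrow> real"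
  show ?thesis
  proof (rule that[of h R])
    show "continuous_map A euclidean h"
      unfolding euclidean_product_topology[symmetric] continuous_map_componentwise_UNIV
      by (simp add: h_def cont_\<delta>)
    show "h y k \<in> {0..1}" for y k using \<delta>01 by (simp add: h_def)
    have "continuous_map euclidean Y (\<lambda>v :: nat \<Rightarrow> real. \<lambda>c\<in>E. v (to_nat_on E c))"
      unfolding Y_def continuous_map_componentwise by auto
    then show "continuous_map euclidean A R"
      using continuous_map_compose[OF _ r(1)] unfolding R_def comp_def by blast
    fix y assume y: "y \<in> K"
    have "(\<lambda>c\<in>E. h y (to_nat_on E c)) = i y"
      using E(1) by (auto simp: h_def i_def)
    then show "R (h y) = y" using y r(2) ji by (simp add: R_def)
  qed
qed

section \<open>Fixed points of maps that stretch along paths\<close>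

lemma crossing_equal_somewhere:
  fixes f g :: "real \<Rightarrow> real"
  assumes "continuous_on {s..t} f" "continuous_on {s..t} g"
    and "u \<in> {s..t}" "f u \<le> g u" and "v \<in> {s..t}" "g v \<le> f v"
  obtains w where "w \<in> {s..t}" "f w = g w"
proof -
  let ?d = "\<lambda>x. f x - g x"
  have "connected (?d ` {s..t})"
    using assms(1,2) by (intro connected_continuous_image continuous_intros) auto
  moreover have "?d u \<in> ?d ` {s..t}" "?d v \<in> ?d ` {s..t}" using assms by auto
  ultimately have "0 \<in> ?d ` {s..t}"
    using assms(4,6) connectedD_interval[of "?d ` {s..t}" "?d u" "?d v" 0] by simp
  then show ?thesis using that by auto
qed

theorem corollary2p1:
  fixes A :: "'a topology" and a b :: real
    and D W :: "(real \<times> 'a) set" and \<phi> :: "real \<times> 'a \<Rightarrow> real \<times> 'a"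
  assumes "absolute_retract A"
    and "a < b"
    and "D \<subseteq> {a..b} \<times> topspace A"
    and "\<phi> \<in> D \<rightarrow> topspace (prod_topology euclideanreal A)"
    and "W \<subseteq> D"
    and "closedin (prod_topology euclideanreal A) W"
    and "compact_map (subtopology (prod_topology euclideanreal A) W)
           (prod_topology euclideanreal A) \<phi>"
    and "\<And>\<sigma> s t.
           \<lbrakk>path_on (prod_topology euclideanreal A) s t \<sigma>;
            \<sigma> ` {s..t} \<subseteq> {a..b} \<times> topspace A;
            \<sigma> ` {s..t} \<inter> ({a} \<times> topspace A) \<noteq> {};
            \<sigma> ` {s..t} \<inter> ({b} \<times> topspace A) \<noteq> {}\<rbrakk>
           \<Longrightarrow> \<exists>s0 s1. s \<le> s0 \<and> s0 \<le> s1 \<and> s1 \<le> t \<and>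
                 \<sigma> ` {s0..s1} \<subseteq> W \<and>
                 \<phi> ` \<sigma> ` {s0..s1} \<subseteq> {a..b} \<times> topspace A \<and>
                 \<phi> ` \<sigma> ` {s0..s1} \<inter> ({a} \<times> topspace A) \<noteq> {} \<and>
                 \<phi> ` \<sigma> ` {s0..s1} \<inter> ({b} \<times> topspace A) \<noteq> {}"
  shows "\<exists>z\<in>W. \<phi> z = z"
proof -
  define X where "X = prod_topology euclideanreal A"
  define B where "B = {a..b} \<times> Hilbert_cube"
  note stretch = assms(8)[folded X_def]
  have W: "closedin X W" using assms(6) by (simp add: X_def)
  then have topW: "topspace (subtopology X W) = W"
    using closedin_subset by (metis topspace_subtopology_subset)
  have cont_\<phi>: "continuous_map (subtopology X W) X \<phi>"
    and comp_\<phi>: "compactin X (X closure_of (\<phi> ` W))"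
    using assms(7) topW by (auto simp: compact_map_def X_def[symmetric])
  have cont_\<phi>1: "continuous_map (subtopology X W) euclideanreal (\<lambda>z. fst (\<phi> z))"
    and cont_\<phi>2: "continuous_map (subtopology X W) A (\<lambda>z. snd (\<phi> z))"
    using continuous_map_compose[OF cont_\<phi>[unfolded X_def] continuous_map_fst]
      continuous_map_compose[OF cont_\<phi>[unfolded X_def] continuous_map_snd]
    by (simp_all add: comp_def X_def)

  \<comment> \<open>\<open>K\<close> is the projection of the closure of the image, not of the image itself, to be compact.\<close>
  define K where "K = snd ` (X closure_of (\<phi> ` W))"
  have K: "compactin A K"
    unfolding K_def using comp_\<phi> by (rule image_compactin) (simp add: X_def continuous_map_snd)
  have \<phi>K: "snd (\<phi> z) \<in> K" if "z \<in> W" for z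
  proof -
    have "\<phi> ` W \<subseteq> topspace X"
      using cont_\<phi> topW continuous_map_image_subset_topspace by metis
    then show ?thesis using that closure_of_subset unfolding K_def by blast
  qed
  obtain h :: "'a \<Rightarrow> nat \<Rightarrow> real" and R where
    h: "continuous_map A euclidean h" "\<And>y k. y \<in> topspace A \<Longrightarrow> h y k \<in> {0..1}" and
    R: "continuous_map euclidean A R" "\<And>y. y \<in> K \<Longrightarrow> R (h y) = y"
    using absolute_retract_factors_through_sequences[OF assms(1) K] by metis
  have R_in: "R u \<in> topspace A" for u
    using R(1) by (auto simp: continuous_map_def)

  define F where "F x = (fst x, R (snd x))" for x :: "real \<times> (nat \<Rightarrow> real)"
  have cont_F: "continuous_map euclidean X F"
  proof -
    have "continuous_map euclidean euclideanreal (fst :: real \<times> (nat \<Rightarrow> real) \<Rightarrow> real)"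
      by (simp add: continuous_on_fst)
    moreover have "continuous_map euclidean euclidean (snd :: real \<times> (nat \<Rightarrow> real) \<Rightarrow> _)"
      by (simp add: continuous_on_snd)
    then have "continuous_map euclidean A (\<lambda>x :: real \<times> (nat \<Rightarrow> real). R (snd x))"
      by (rule continuous_map_compose[OF _ R(1), unfolded comp_def])
    ultimately show ?thesis
      unfolding X_def F_def by (simp add: continuous_map_paired)
  qed

  have cont_h\<phi>: "continuous_map (subtopology X W) euclidean (\<lambda>z. h (snd (\<phi> z)))"
    using continuous_map_compose[OF cont_\<phi>2 h(1)] by (simp add: comp_def)
  have normal: "normal_space X"
    using assms(1) unfolding X_def absolute_retract_def
    by (simp add: metrizable_imp_normal_space metrizable_space_prod_topology metrizable_space_euclidean)
  have "\<exists>e. continuous_map X euclideanreal e \<and> (\<forall>z\<in>W. e z = h (snd (\<phi> z)) k) \<and> e ` topspace X \<subseteq> {0..1}" for k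
  proof -
    have "continuous_map (subtopology X W) euclideanreal (\<lambda>z. h (snd (\<phi> z)) k)"
      using cont_h\<phi> unfolding euclidean_product_topology[symmetric] continuous_map_componentwise_UNIV
      by blast
    moreover have "(\<lambda>z. h (snd (\<phi> z)) k) ` W \<subseteq> {0..1}"
      using h(2) \<phi>K compactin_subset_topspace[OF K] by blast
    ultimately show ?thesis
      using Tietze_extension_closed_real_interval[OF normal W, of "\<lambda>z. h (snd (\<phi> z)) k" 0 1]
      by (metis zero_le_one)
  qed
  then obtain e where e: "\<And>k. continuous_map X euclideanreal (e k)"
    "\<And>k z. z \<in> W \<Longrightarrow> e k z = h (snd (\<phi> z)) k" "\<And>k. e k ` topspace X \<subseteq> {0..1}"
    by metis
  define G where "G x = (\<lambda>k. e k (F x))" for x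
  have "continuous_on UNIV (\<lambda>x. G x k)" for k
    using continuous_map_compose[OF cont_F e(1)[of k]] by (simp add: G_def comp_def)
  then have cont_G: "continuous_on B G"
    by (intro continuous_on_coordinatewise_then_product) (meson continuous_on_subset subset_UNIV)
  have G_cube: "G \<in> B \<rightarrow> Hilbert_cube"
  proof -
    have "F x \<in> topspace X" for x using R_in by (simp add: F_def X_def)
    then have "e k (F x) \<in> {0..1}" for k x using e(3)[of k] by blast
    then show ?thesis by (simp add: G_def Hilbert_cube_def)
  qed
  have G_W: "G x = h (snd (\<phi> (F x)))" if "F x \<in> W" for x
    using e(2)[OF that] by (simp add: G_def)

  \<comment> \<open>The second equation holds exactly on \<open>P\<close>; the first one holds where the distance below vanishes.\<close>
  define P where "P = {x \<in> B. F x \<in> W \<and> fst (\<phi> (F x)) = fst x}"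
  have near: "\<exists>x\<in>P. dist (snd x) (h (snd (\<phi> (F x)))) < \<delta>" if \<delta>: "0 < \<delta>" for \<delta>
  proof -
    obtain p where p: "path p" "path_image p \<subseteq> {x \<in> B. dist (snd x) (G x) < \<delta>}"
      "fst (pathstart p) = a" "fst (pathfinish p) = b"
      by (rule approximate_solution_path[OF assms(2), folded B_def, OF cont_G G_cube \<delta>])
    have pB: "p t \<in> B" "dist (snd (p t)) (G (p t)) < \<delta>" if "t \<in> {0..1}" for t
      using p(2) that unfolding path_image_def by blast+
    have cont_p: "continuous_on {0..1} p" using p(1) by (simp add: path_def)
    define \<sigma> where "\<sigma> = (\<lambda>t. F (p t))"
    have cont_\<sigma>: "continuous_map (top_of_set {0..1}) X \<sigma>"
      unfolding \<sigma>_def using cont_p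
      by (intro continuous_map_compose[OF _ cont_F, unfolded comp_def]) simp
    have "path_on X 0 1 \<sigma>" using cont_\<sigma> by (simp add: path_on_def)
    moreover have "\<sigma> ` {0..1} \<subseteq> {a..b} \<times> topspace A"
      using pB(1) R_in by (force simp: \<sigma>_def F_def B_def)
    moreover have "\<sigma> 0 \<in> {a} \<times> topspace A" "\<sigma> 1 \<in> {b} \<times> topspace A"
      using p(3,4) R_in by (simp_all add: \<sigma>_def F_def pathstart_def pathfinish_def)
    then have "\<sigma> ` {0..1} \<inter> ({a} \<times> topspace A) \<noteq> {}" "\<sigma> ` {0..1} \<inter> ({b} \<times> topspace A) \<noteq> {}"
      by (metis IntI atLeastAtMost_iff empty_iff imageI order_refl zero_le_one)+
    ultimately obtain s0 s1 where s: "0 \<le> s0" "s0 \<le> s1" "s1 \<le> 1" and sW: "\<sigma> ` {s0..s1} \<subseteq> W"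
      and cross: "\<phi> ` \<sigma> ` {s0..s1} \<inter> ({a} \<times> topspace A) \<noteq> {}"
        "\<phi> ` \<sigma> ` {s0..s1} \<inter> ({b} \<times> topspace A) \<noteq> {}"
      using stretch by metis
    have sub: "{s0..s1} \<subseteq> {0..1}" using s by auto
    have "continuous_map (top_of_set {s0..s1}) (subtopology X W) \<sigma>"
      using continuous_map_from_subtopology_mono[OF cont_\<sigma> sub] sW
      by (auto simp: continuous_map_in_subtopology)
    from continuous_map_compose[OF this cont_\<phi>1]
    have c1: "continuous_on {s0..s1} (\<lambda>t. fst (\<phi> (\<sigma> t)))" by (simp add: comp_def)
    have c2: "continuous_on {s0..s1} (\<lambda>t. fst (p t))"
      using continuous_on_subset[OF cont_p sub] by (rule continuous_on_fst)
    have between: "a \<le> fst (p t) \<and> fst (p t) \<le> b" if "t \<in> {s0..s1}" for t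
      using pB(1)[of t] sub that by (auto simp: B_def)
    have hits: "\<exists>u\<in>{s0..s1}. fst (\<phi> (\<sigma> u)) = c"
      if meets: "\<phi> ` \<sigma> ` {s0..s1} \<inter> ({c} \<times> topspace A) \<noteq> {}" for c
    proof -
      obtain y where "y \<in> (\<lambda>u. \<phi> (\<sigma> u)) ` {s0..s1}" and y: "y \<in> {c} \<times> topspace A"
        using meets unfolding image_image ex_in_conv[symmetric] Int_iff by (elim exE conjE)
      then obtain u where "u \<in> {s0..s1}" "y = \<phi> (\<sigma> u)" by (elim imageE)
      then show ?thesis using y by (intro bexI[of _ u]) (simp_all add: mem_Times_iff)
    qed
    obtain u v where u: "u \<in> {s0..s1}" "fst (\<phi> (\<sigma> u)) = a" and v: "v \<in> {s0..s1}" "fst (\<phi> (\<sigma> v)) = b"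
      using hits cross by metis
    obtain t where t: "t \<in> {s0..s1}" "fst (\<phi> (\<sigma> t)) = fst (p t)"
      using crossing_equal_somewhere[OF c1 c2 u(1) _ v(1)] u v between by metis
    then have t01: "t \<in> {0..1}" using sub by blast
    have FW: "F (p t) \<in> W" using t(1) sW by (auto simp: \<sigma>_def)
    then have "p t \<in> P" using t pB(1)[OF t01] by (simp add: P_def \<sigma>_def)
    then show ?thesis using pB(2)[OF t01] G_W[OF FW] by metis
  qed

  \<comment> \<open>Continuity of \<open>\<phi>\<close> is given only on \<open>W\<close>, so \<open>P\<close> is cut out of the compact set \<open>P0\<close> of points over \<open>W\<close>.\<close>
  define P0 where "P0 = B \<inter> {x. F x \<in> W}"
  have "closed {x. F x \<in> W}"
    using closedin_continuous_map_preimage[OF cont_F W] by simp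
  then have P0: "compact P0"
    unfolding P0_def B_def by (intro compact_Int_closed compact_Times compact_Hilbert_cube) auto
  have cont_F0: "continuous_map (top_of_set P0) (subtopology X W) F"
    using cont_F by (auto simp: P0_def continuous_map_in_subtopology intro: continuous_map_from_subtopology)
  have "continuous_on P0 (\<lambda>x. fst (\<phi> (F x)) - fst x)"
    using continuous_map_compose[OF cont_F0 cont_\<phi>1]
    by (intro continuous_intros) (simp add: comp_def)
  then have "closedin (top_of_set P0) {x \<in> P0. fst (\<phi> (F x)) - fst x = 0}"
    by (rule continuous_closedin_preimage_constant)
  moreover have "{x \<in> P0. fst (\<phi> (F x)) - fst x = 0} = P"
    by (auto simp: P_def P0_def)
  ultimately have P: "compact P" using P0 closedin_compact by metis
  have "continuous_on P0 (\<lambda>x. h (snd (\<phi> (F x))))"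
    using continuous_map_compose[OF cont_F0 cont_h\<phi>] by (simp add: comp_def)
  then have "continuous_on P0 (\<lambda>x. dist (snd x) (h (snd (\<phi> (F x)))))"
    by (rule continuous_on_dist[OF continuous_on_snd[OF continuous_on_id]])
  then have "continuous_on P (\<lambda>x. dist (snd x) (h (snd (\<phi> (F x)))))"
    by (rule continuous_on_subset) (auto simp: P_def P0_def)
  moreover have "P \<noteq> {}" using near[of 1] by auto
  ultimately obtain x where x: "x \<in> P"
    "\<And>y. y \<in> P \<Longrightarrow> dist (snd x) (h (snd (\<phi> (F x)))) \<le> dist (snd y) (h (snd (\<phi> (F y))))"
    using continuous_attains_inf[OF P] by meson
  have "dist (snd x) (h (snd (\<phi> (F x)))) = 0"
    using near x(2) by (metis not_le zero_le_dist less_eq_real_def)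
  then have eq: "snd x = h (snd (\<phi> (F x)))" by simp
  have FW: "F x \<in> W" "fst (\<phi> (F x)) = fst x" using x(1) by (auto simp: P_def)
  have "R (snd x) = snd (\<phi> (F x))" using eq R(2)[OF \<phi>K[OF FW(1)]] by metis
  then have "\<phi> (F x) = F x" using FW(2) by (simp add: F_def prod_eq_iff)
  then show ?thesis using FW(1) by blast
qed

end
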